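(* Let $\mathcal{A}=(a_{i_1i_2\cdots i_m})$ be an order $m$ dimension $n$ nonnegative weakly irreducible tensor, with slice sums $K_i=\sum_{i_2,\ldots,i_m=1}^n a_{ii_2\cdots i_m}$ satisfying $K_1\leqslant K_2\leqslant\cdots\leqslant K_n$, and let $g$ be the girth of $G_{\mathcal{A}}$. Then \[ (K_1K_2\cdots K_g)^{\frac{1}{g}}\leqslant \rho(\mathcal{A})\leqslant (K_{n-g+1}K_{n-g+2}\cdots K_n)^{\frac{1}{g}}. \]
   Context: For an order $m$ dimension $n$ tensor $\mathcal{A}$: $(\mathcal{A}x^{m-1})_i=\sum_{i_2,\ldots,i_m}a_{ii_2\cdots i_m}x_{i_2}\cdots x_{i_m}$; $\lambda\in\mathbb{C}$ is an eigenvalue if $\mathcal{A}x^{m-1}=\lambda(x_1^{m-1},\ldots,x_n^{m-1})^{\mathrm T}$ for some nonzero $x\in\mathbb{C}^n$; $\rho(\mathcal{A})$ is the maximum modulus of eigenvalues. The digraph $G_{\mathcal{A}}$ has vertices $\{1,\ldots,n\}$ and an arc $(i,j)$ whenever $a_{ii_2\cdots i_m}\neq0$ for some $i_2,\ldots,i_m$ with $j\in\{i_2,\ldots,i_m\}$ (loops allowed). $\mathcal{A}$ is weakly irreducible if $G_{\mathcal{A}}$ is strongly connected. A circuit is a directed closed path $i_1\to\cdots\to i_p\to i_1$ with $i_1,\ldots,i_p$ distinct (a loop is a circuit of length 1); the girth of $G_{\mathcal{A}}$ is the shortest length of a circuit in it. *)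

theory Defs
  imports Complex_Main "HOL-Library.Extended_Nat" "Graph_Theory.Graph_Theory"
begin

text \<open>
  An order \<open>m\<close> dimension \<open>n\<close> tensor is a function \<open>A\<close> on index lists; only its values on
  \<open>index_tuples n m\<close> matter. Vectors of dimension \<open>n\<close> are functions on \<open>nat\<close> of which only the
  values on \<open>{1..n}\<close> matter.
\<close>

definition index_tuples :: "nat \<Rightarrow> nat \<Rightarrow> nat list set" where
  "index_tuples n k = {is. set is \<subseteq> {1..n} \<and> length is = k}"

definition nonneg_tensor :: "nat \<Rightarrow> nat \<Rightarrow> (nat list \<Rightarrow> real) \<Rightarrow> bool" where
  "nonneg_tensor m n A \<longleftrightarrow> (\<forall>is\<in>index_tuples n m. A is \<ge> 0)"

definition slice_sum :: "nat \<Rightarrow> nat \<Rightarrow> (nat list \<Rightarrow> real) \<Rightarrow> nat \<Rightarrow> real" where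
  "slice_sum m n A i = (\<Sum>js\<in>index_tuples n (m - 1). A (i # js))"

definition tensor_apply :: "nat \<Rightarrow> nat \<Rightarrow> (nat list \<Rightarrow> complex) \<Rightarrow> (nat \<Rightarrow> complex) \<Rightarrow> nat \<Rightarrow> complex" where
  "tensor_apply m n A x i = (\<Sum>js\<in>index_tuples n (m - 1). A (i # js) * (\<Prod>j\<leftarrow>js. x j))"

definition tensor_eigenvalue :: "nat \<Rightarrow> nat \<Rightarrow> (nat list \<Rightarrow> complex) \<Rightarrow> complex \<Rightarrow> bool" where
  "tensor_eigenvalue m n A l \<longleftrightarrow>
     (\<exists>x. (\<exists>i\<in>{1..n}. x i \<noteq> 0) \<and> (\<forall>i\<in>{1..n}. tensor_apply m n A x i = l * x i ^ (m - 1)))"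

text \<open>
  A genuine maximum: unlike a supremum, it is only specified if some eigenvalue attains it.
\<close>

definition tensor_spectral_radius :: "nat \<Rightarrow> nat \<Rightarrow> (nat list \<Rightarrow> complex) \<Rightarrow> real" where
  "tensor_spectral_radius m n A = (GREATEST r. \<exists>l. tensor_eigenvalue m n A l \<and> r = cmod l)"

definition tensor_digraph :: "nat \<Rightarrow> nat \<Rightarrow> (nat list \<Rightarrow> 'a::zero) \<Rightarrow> (nat, nat \<times> nat) pre_digraph" where
  "tensor_digraph m n A =
     \<lparr>verts = {1..n},
      arcs = {(i, j). i \<in> {1..n} \<and> (\<exists>js\<in>index_tuples n (m - 1). A (i # js) \<noteq> 0 \<and> j \<in> set js)},
      tail = fst, head = snd\<rparr>"

definition weakly_irreducible :: "nat \<Rightarrow> nat \<Rightarrow> (nat list \<Rightarrow> 'a::zero) \<Rightarrow> bool" where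
  "weakly_irreducible m n A \<longleftrightarrow> strongly_connected (tensor_digraph m n A)"

text \<open>
  \<^const>\<open>pre_digraph.cycle\<close> is a nonempty closed arc walk without repeated vertices, loops included.
  The girth of a digraph without circuits is \<open>\<infinity>\<close>.
\<close>

definition digraph_girth :: "('a, 'b) pre_digraph \<Rightarrow> enat" where
  "digraph_girth G = (INF p\<in>{p. pre_digraph.cycle G p}. enat (length p))"

end

theory Submission
  imports Defs "HOL-Analysis.Function_Topology" "HOL-Combinatorics.Orbits"
begin

text \<open>
  Minimising \<open>max\<^sub>i (A x\<^bsup>m-1\<^esup>)\<^sub>i / x\<^sub>i\<^bsup>m-1\<^esup>\<close> over positive \<open>x\<close> yields a positive eigenvector, whose
  eigenvalue \<open>l\<close> dominates every complex eigenvalue \<open>\<mu>\<close> (compare at the index where \<open>|z\<^sub>i| / x\<^sub>i\<close> is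
  largest, \<open>z\<close> being an eigenvector of \<open>\<mu>\<close>), so that \<open>l\<close> is the spectral radius. If \<open>f i\<close> is an
  out-neighbour of \<open>i\<close> with largest coordinate, then \<open>l x\<^sub>i\<^bsup>m-1\<^esup> \<le> K\<^sub>i y\<^bsup>m-1\<^esup>\<close>, where \<open>y\<close> is the
  coordinate at \<open>f i\<close>; multiplying along a circuit of \<open>f\<close>, of length \<open>p \<ge> g\<close>, bounds \<open>l\<close> by the
  geometric mean of \<open>p\<close> of the \<open>K\<^sub>i\<close>, hence by that of the \<open>g\<close> largest ones. The lower bound is dual.
\<close>

section \<open>Order properties of products over index lists\<close>

lemma prod_list_map_nonneg:
  fixes x :: "'a \<Rightarrow> real"
  assumes "\<And>j. j \<in> set js \<Longrightarrow> 0 \<le> x j"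
  shows "0 \<le> (\<Prod>j\<leftarrow>js. x j)"
  using assms by (induction js) auto

lemma prod_list_map_pos:
  fixes x :: "'a \<Rightarrow> real"
  assumes "\<And>j. j \<in> set js \<Longrightarrow> 0 < x j"
  shows "0 < (\<Prod>j\<leftarrow>js. x j)"
  using assms by (induction js) auto

lemma prod_list_map_mono:
  fixes x y :: "'a \<Rightarrow> real"
  assumes "\<And>j. j \<in> set js \<Longrightarrow> 0 \<le> x j \<and> x j \<le> y j"
  shows "(\<Prod>j\<leftarrow>js. x j) \<le> (\<Prod>j\<leftarrow>js. y j)"
  using assms
proof (induction js)
  case (Cons a js)
  have "0 \<le> x a" "x a \<le> y a"
    using Cons.prems[of a] by auto
  moreover have "(\<Prod>j\<leftarrow>js. x j) \<le> (\<Prod>j\<leftarrow>js. y j)"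
    using Cons by auto
  moreover have "0 \<le> (\<Prod>j\<leftarrow>js. x j)"
    using Cons.prems by (intro prod_list_map_nonneg) auto
  ultimately show ?case
    by (auto intro!: mult_mono)
qed auto

text \<open>Positivity of all factors keeps the one strict inequality from being absorbed by a
  zero.\<close>

lemma prod_list_map_strict_mono:
  fixes x y :: "'a \<Rightarrow> real"
  assumes "\<And>j. j \<in> set js \<Longrightarrow> 0 < x j \<and> x j \<le> y j" and "i \<in> set js" and "x i < y i"
  shows "(\<Prod>j\<leftarrow>js. x j) < (\<Prod>j\<leftarrow>js. y j)"
  using assms
proof (induction js)
  case (Cons a js)
  have a: "0 < x a" "x a \<le> y a"
    using Cons.prems(1)[of a] by auto
  have le: "(\<Prod>j\<leftarrow>js. x j) \<le> (\<Prod>j\<leftarrow>js. y j)"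
    by (rule prod_list_map_mono) (use Cons.prems(1) in \<open>auto intro: less_imp_le\<close>)
  have pos: "0 < (\<Prod>j\<leftarrow>js. x j)"
    using Cons.prems by (intro prod_list_map_pos) auto
  show ?case
  proof (cases "a = i")
    case True
    then show ?thesis
      using Cons.prems(3) a le pos by (auto intro!: mult_less_le_imp_less)
  next
    case False
    then have "(\<Prod>j\<leftarrow>js. x j) < (\<Prod>j\<leftarrow>js. y j)"
      using Cons by auto
    then show ?thesis
      using a pos by (auto intro!: mult_le_less_imp_less)
  qed
qed auto

lemma prod_list_map_const: "(\<Prod>j\<leftarrow>js. c) = (c :: 'a :: comm_monoid_mult) ^ length js"
  by (induction js) auto

lemma prod_list_map_mult_left:
  "(\<Prod>j\<leftarrow>js. c * x j) = (c :: 'a :: comm_monoid_mult) ^ length js * (\<Prod>j\<leftarrow>js. x j)"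
  by (induction js) (auto simp: mult_ac)

text \<open>The remaining factors multiply to at least 1. This isolates a single coordinate from a
  monomial of the tensor.\<close>

lemma le_prod_list_map:
  fixes x :: "'a \<Rightarrow> real"
  assumes "\<And>j. j \<in> set js \<Longrightarrow> 1 \<le> x j" and "i \<in> set js"
  shows "x i \<le> (\<Prod>j\<leftarrow>js. x j)"
  using assms
proof (induction js)
  case (Cons a js)
  have ge1: "1 \<le> (\<Prod>j\<leftarrow>js. x j)"
    using prod_list_map_mono[of js "\<lambda>_. 1" x] Cons.prems by (auto simp: prod_list_map_const)
  have a: "1 \<le> x a"
    using Cons.prems(1)[of a] by auto
  show ?case
  proof (cases "a = i")
    case True
    then show ?thesis
      using mult_left_mono[OF ge1, of "x i"] a by auto
  next
    case False
    then have "x i \<le> (\<Prod>j\<leftarrow>js. x j)"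
      using Cons by auto
    also have "\<dots> \<le> x a * (\<Prod>j\<leftarrow>js. x j)"
      using mult_right_mono[OF a, of "\<Prod>j\<leftarrow>js. x j"] ge1 by linarith
    finally show ?thesis
      by simp
  qed
qed auto

section \<open>Continuity, compactness and an averaging inequality\<close>

lemma continuous_on_prod_list_map:
  fixes f :: "'a \<Rightarrow> 'b :: topological_space \<Rightarrow> real"
  assumes "\<And>j. continuous_on S (f j)"
  shows "continuous_on S (\<lambda>x. \<Prod>j\<leftarrow>js. f j x)"
  using assms by (induction js) (auto intro!: continuous_intros)

lemma continuous_on_coordinate: "continuous_on S (\<lambda>x :: 'a \<Rightarrow> 'b :: topological_space. x i)"
  by (rule continuous_on_subset[OF continuous_on_product_coordinates]) simp

lemma continuous_on_Max_image:
  fixes f :: "'a \<Rightarrow> 'b :: topological_space \<Rightarrow> real"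
  assumes "finite I" "I \<noteq> {}" "\<And>i. i \<in> I \<Longrightarrow> continuous_on S (f i)"
  shows "continuous_on S (\<lambda>x. Max ((\<lambda>i. f i x) ` I))"
  using assms
  by (induction rule: finite_ne_induct) (auto intro!: continuous_on_max)

text \<open>Tychonoff's theorem in the topology of the function type, where the minimisation takes
  place.\<close>

lemma compact_PiE_UNIV:
  fixes S :: "'a \<Rightarrow> 'b :: topological_space set"
  assumes "\<And>i. compact (S i)"
  shows "compact (Pi\<^sub>E UNIV S)"
  using assms
  by (metis compactin_PiE compactin_euclidean_iff euclidean_product_topology)

text \<open>After subtracting the threshold \<open>c\<close>, indices of \<open>T\<close> outside
  \<open>B\<close> contribute at most 0 and dropping indices of \<open>B\<close> cannot increase the
  sum. The sum over \<open>B\<close> is then nonnegative, so dividing by the larger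
  \<open>card T\<close> gives no more. The case \<open>card B < card T\<close> arises from circuits
  longer than the girth.\<close>

lemma average_le_top_average:
  fixes u :: "'a \<Rightarrow> real"
  assumes V: "finite V" and B: "B \<subseteq> V" "0 < card B" and T: "T \<subseteq> V" "card B \<le> card T"
    and ge: "\<And>i. i \<in> B \<Longrightarrow> c \<le> u i" and le: "\<And>i. i \<in> V - B \<Longrightarrow> u i \<le> c"
  shows "sum u T / card T \<le> sum u B / card B"
proof -
  define w where "w = (\<lambda>i. u i - c)"
  have fin: "finite B" "finite T"
    using V B T finite_subset by auto
  have "sum w T = sum w (T \<inter> B) + sum w (T - B)"
    using fin by (subst sum.Int_Diff[of _ _ B]) auto
  also have "sum w (T - B) \<le> 0"
    using le T by (intro sum_nonpos) (auto simp: w_def)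
  also have "sum w (T \<inter> B) \<le> sum w B"
    using ge fin by (intro sum_mono2) (auto simp: w_def)
  finally have "sum w T \<le> sum w B"
    by simp
  moreover have "0 \<le> sum w B"
    using ge by (intro sum_nonneg) (auto simp: w_def)
  ultimately have "sum w T / card T \<le> sum w B / card B"
    using B(2) T(2) by (intro frac_le) auto
  then show ?thesis
    using B(2) T(2) by (simp add: w_def sum_subtractf diff_divide_distrib)
qed

section \<open>The real tensor map and its digraph\<close>

lemma finite_index_tuples: "finite (index_tuples n k)"
  unfolding index_tuples_def by (rule finite_lists_length_eq) simp

text \<open>Real counterpart of \<open>tensor_apply\<close>, on which order comparisons make sense;
  \<open>tensor_apply_of_real\<close> links the two.\<close>

definition tensor_apply_real :: "nat \<Rightarrow> nat \<Rightarrow> (nat list \<Rightarrow> real) \<Rightarrow> (nat \<Rightarrow> real) \<Rightarrow> nat \<Rightarrow> real" where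
  "tensor_apply_real m n A x i = (\<Sum>js\<in>index_tuples n (m - 1). A (i # js) * (\<Prod>j\<leftarrow>js. x j))"

lemma tensor_apply_real_cong:
  assumes "\<And>j. j \<in> {1..n} \<Longrightarrow> x j = y j"
  shows "tensor_apply_real m n A x i = tensor_apply_real m n A y i"
  unfolding tensor_apply_real_def
proof (rule sum.cong)
  fix js assume "js \<in> index_tuples n (m - 1)"
  then have eq: "map x js = map y js"
    using assms by (auto simp: index_tuples_def)
  then show "A (i # js) * (\<Prod>j\<leftarrow>js. x j) = A (i # js) * (\<Prod>j\<leftarrow>js. y j)"
    by (simp only: eq)
qed simp

lemma tensor_apply_real_scale:
  "tensor_apply_real m n A (\<lambda>j. c * x j) i = c ^ (m - 1) * tensor_apply_real m n A x i"
  unfolding tensor_apply_real_def sum_distrib_left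
  by (rule sum.cong) (auto simp: prod_list_map_mult_left index_tuples_def)

lemma tensor_apply_real_one: "tensor_apply_real m n A (\<lambda>_. 1) i = slice_sum m n A i"
  by (simp add: tensor_apply_real_def slice_sum_def prod_list_map_const)

lemma tensor_apply_of_real:
  "tensor_apply m n (\<lambda>is. complex_of_real (A is)) (\<lambda>j. complex_of_real (x j)) i =
     complex_of_real (tensor_apply_real m n A x i)"
proof -
  have "(\<Prod>j\<leftarrow>js. complex_of_real (x j)) = complex_of_real (\<Prod>j\<leftarrow>js. x j)" for js
    by (induction js) auto
  then show ?thesis
    by (simp add: tensor_apply_def tensor_apply_real_def)
qed

lemma continuous_on_tensor_apply_real:
  "continuous_on S (\<lambda>x. tensor_apply_real m n A x i)"
  unfolding tensor_apply_real_def
  by (intro continuous_intros continuous_on_prod_list_map continuous_on_coordinate)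

lemma arcs_tensor_digraph:
  "(i, j) \<in> arcs (tensor_digraph m n A) \<longleftrightarrow>
     i \<in> {1..n} \<and> (\<exists>js\<in>index_tuples n (m - 1). A (i # js) \<noteq> 0 \<and> j \<in> set js)"
  by (simp add: tensor_digraph_def)

lemma arc_tensor_digraph_verts:
  "(i, j) \<in> arcs (tensor_digraph m n A) \<Longrightarrow> i \<in> {1..n} \<and> j \<in> {1..n}"
  by (auto simp: arcs_tensor_digraph index_tuples_def)

lemma tensor_digraph_simps:
  "verts (tensor_digraph m n A) = {1..n}" "tail (tensor_digraph m n A) = fst" "head (tensor_digraph m n A) = snd"
  by (simp_all add: tensor_digraph_def)

lemma wf_tensor_digraph: "wf_digraph (tensor_digraph m n A)"
  by standard (auto simp: tensor_digraph_def index_tuples_def)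

section \<open>Consequences of weak irreducibility\<close>

text \<open>A finite girth provides \<open>arcs_nonempty\<close>. It excludes the single vertex
  without a loop, which is strongly connected too, and forces \<open>m\<close> to be at least
  2.\<close>

locale weakly_irreducible_tensor =
  fixes m n :: nat and A :: "nat list \<Rightarrow> real"
  assumes nonneg: "nonneg_tensor m n A"
    and irreducible: "weakly_irreducible m n A"
    and arcs_nonempty: "arcs (tensor_digraph m n A) \<noteq> {}"
begin

abbreviation "V \<equiv> {1..n}"
abbreviation "E \<equiv> arcs (tensor_digraph m n A)"
abbreviation "T \<equiv> tensor_apply_real m n A"

lemma entry_nonneg: "i \<in> V \<Longrightarrow> js \<in> index_tuples n (m - 1) \<Longrightarrow> 0 \<le> A (i # js)"
proof -
  assume i: "i \<in> V" and js: "js \<in> index_tuples n (m - 1)"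
  obtain a b where "(a, b) \<in> E"
    using arcs_nonempty by auto
  \<comment> \<open>An arc needs a nonempty list \<open>js\<close>. Without this,
    \<open>m = 0\<close> would make \<open>m - 1\<close> truncate and \<open>i # js\<close> too
    long.\<close>
  then have "m - 1 \<noteq> 0"
    by (auto simp: arcs_tensor_digraph index_tuples_def)
  then have "i # js \<in> index_tuples n m"
    using i js by (auto simp: index_tuples_def)
  then show ?thesis
    using nonneg by (auto simp: nonneg_tensor_def)
qed

lemma rtrancl_arcs: "i \<in> V \<Longrightarrow> j \<in> V \<Longrightarrow> (i, j) \<in> E\<^sup>*"
proof -
  assume "i \<in> V" "j \<in> V"
  then have "reachable (tensor_digraph m n A) i j"
    using irreducible by (auto simp: weakly_irreducible_def strongly_connected_def tensor_digraph_def)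
  moreover have "arcs_ends (tensor_digraph m n A) = E"
    by (auto simp: arcs_ends_def arc_to_ends_def tensor_digraph_def)
  ultimately show ?thesis
    using reachable_rtranclI by metis
qed

lemma V_nonempty: "V \<noteq> {}"
  using arcs_nonempty arc_tensor_digraph_verts by fast

text \<open>A path from \<open>i\<close> to the tail of some arc is either empty, so that
  \<open>i\<close> is this tail, or begins with an arc out of \<open>i\<close>.\<close>

lemma out_arc: "i \<in> V \<Longrightarrow> \<exists>j. (i, j) \<in> E"
proof -
  assume i: "i \<in> V"
  obtain a b where ab: "(a, b) \<in> E"
    using arcs_nonempty by auto
  then have "(i, a) \<in> E\<^sup>*"
    using rtrancl_arcs i arc_tensor_digraph_verts by blast
  then show ?thesis
    using ab by (auto elim: converse_rtranclE)
qed

text \<open>Every vertex has a path into \<open>S\<close>, along which membership propagates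
  backwards. In contrapositive form, a nonempty proper subset of \<open>V\<close> is entered by an
  arc from outside.\<close>

lemma backward_closed_eq_V:
  assumes "S \<subseteq> V" "S \<noteq> {}" and "\<And>k i. (k, i) \<in> E \<Longrightarrow> i \<in> S \<Longrightarrow> k \<in> S"
  shows "S = V"
proof -
  obtain i where i: "i \<in> S"
    using assms by auto
  have "k \<in> S" if "(k, i) \<in> E\<^sup>*" for k
    using that by (induction rule: converse_rtrancl_induct) (use i assms(3) in auto)
  then show ?thesis
    using rtrancl_arcs assms(1) i by blast
qed

section \<open>Monotonicity and positivity of the tensor map\<close>

lemma apply_mono:
  assumes "i \<in> V" and "\<And>j. j \<in> V \<Longrightarrow> 0 \<le> x j \<and> x j \<le> y j"
  shows "T x i \<le> T y i"
  unfolding tensor_apply_real_def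
proof (intro sum_mono mult_left_mono)
  fix js assume js: "js \<in> index_tuples n (m - 1)"
  then show "(\<Prod>j\<leftarrow>js. x j) \<le> (\<Prod>j\<leftarrow>js. y j)"
    by (intro prod_list_map_mono assms(2)) (auto simp: index_tuples_def)
  show "0 \<le> A (i # js)"
    using entry_nonneg assms js by auto
qed

text \<open>The arc supplies a positive entry whose monomial contains the coordinate
  \<open>i\<close>. As no other coordinate vanishes, this monomial grows strictly.\<close>

lemma apply_strict_mono:
  assumes "(k, i) \<in> E" and "\<And>j. j \<in> V \<Longrightarrow> 0 < x j \<and> x j \<le> y j" and "x i < y i"
  shows "T x k < T y k"
proof -
  obtain js where js: "js \<in> index_tuples n (m - 1)" "A (k # js) \<noteq> 0" "i \<in> set js"
    using assms(1) by (auto simp: arcs_tensor_digraph)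
  have k: "k \<in> V"
    using assms(1) arc_tensor_digraph_verts by blast
  have xy: "0 \<le> x j" "x j \<le> y j" if "j \<in> V" for j
    using assms(2)[OF that] by linarith+
  show ?thesis
    unfolding tensor_apply_real_def
  proof (rule sum_strict_mono_ex1[OF finite_index_tuples], intro ballI mult_left_mono)
    fix ks assume ks: "ks \<in> index_tuples n (m - 1)"
    then show "(\<Prod>j\<leftarrow>ks. x j) \<le> (\<Prod>j\<leftarrow>ks. y j)"
      using xy by (intro prod_list_map_mono) (auto simp: index_tuples_def)
    show "0 \<le> A (k # ks)"
      using entry_nonneg k ks by auto
  next
    have "(\<Prod>j\<leftarrow>js. x j) < (\<Prod>j\<leftarrow>js. y j)"
      using js assms(2,3) by (intro prod_list_map_strict_mono[of _ _ _ i]) (auto simp: index_tuples_def)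
    moreover have "0 < A (k # js)"
      using entry_nonneg[OF k js(1)] js(2) by simp
    ultimately have "A (k # js) * (\<Prod>j\<leftarrow>js. x j) < A (k # js) * (\<Prod>j\<leftarrow>js. y j)"
      by (rule mult_strict_left_mono)
    then show "\<exists>js\<in>index_tuples n (m - 1).
        A (k # js) * (\<Prod>j\<leftarrow>js. x j) < A (k # js) * (\<Prod>j\<leftarrow>js. y j)"
      using js(1) by blast
  qed
qed

lemma term_le_apply:
  assumes "i \<in> V" and "\<And>j. j \<in> V \<Longrightarrow> 0 \<le> x j" and "js \<in> index_tuples n (m - 1)"
  shows "A (i # js) * (\<Prod>j\<leftarrow>js. x j) \<le> T x i"
  unfolding tensor_apply_real_def
proof (rule member_le_sum[OF assms(3) _ finite_index_tuples])
  fix ks assume "ks \<in> index_tuples n (m - 1) - {js}"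
  then show "0 \<le> A (i # ks) * (\<Prod>j\<leftarrow>ks. x j)"
    using assms entry_nonneg
    by (intro mult_nonneg_nonneg prod_list_map_nonneg) (auto simp: index_tuples_def)
qed

lemma apply_nonneg:
  assumes "i \<in> V" and "\<And>j. j \<in> V \<Longrightarrow> 0 \<le> x j"
  shows "0 \<le> T x i"
  unfolding tensor_apply_real_def
  using assms entry_nonneg
  by (intro sum_nonneg mult_nonneg_nonneg prod_list_map_nonneg) (auto simp: index_tuples_def)

lemma apply_pos:
  assumes "i \<in> V" and "\<And>j. j \<in> V \<Longrightarrow> 0 < x j"
  shows "0 < T x i"
proof -
  obtain js where js: "js \<in> index_tuples n (m - 1)" "A (i # js) \<noteq> 0"
    using out_arc[OF assms(1)] by (auto simp: arcs_tensor_digraph)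
  have "0 < A (i # js)"
    using entry_nonneg[OF assms(1) js(1)] js(2) by simp
  then have "0 < A (i # js) * (\<Prod>j\<leftarrow>js. x j)"
    using js(1) assms(2) by (intro mult_pos_pos prod_list_map_pos) (auto simp: index_tuples_def)
  also have "\<dots> \<le> T x i"
    using assms js(1) by (intro term_le_apply) (auto intro: less_imp_le)
  finally show ?thesis .
qed

section \<open>Existence of a positive eigenvector\<close>

text \<open>
  All other coordinates being at least \<open>1\<close>, an arc \<open>(j, k)\<close> turns a bound on \<open>x j\<close> into one on \<open>x k\<close>.
\<close>

lemma super_eigenvector_path_bound:
  assumes "0 \<le> C" and "(i, j) \<in> E\<^sup>*"
  shows "\<exists>B. \<forall>x. (\<forall>k\<in>V. 1 \<le> x k) \<longrightarrow> (\<forall>k\<in>V. T x k \<le> C * x k ^ (m - 1)) \<longrightarrow> x i = 1 \<longrightarrow> x j \<le> B"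
  using assms(2)
proof (induction rule: rtrancl_induct)
  case base
  then show ?case
    by (auto intro!: exI[of _ 1])
next
  case (step j k)
  then obtain B where B: "\<And>x. \<forall>k\<in>V. 1 \<le> x k \<Longrightarrow> \<forall>k\<in>V. T x k \<le> C * x k ^ (m - 1) \<Longrightarrow> x i = 1 \<Longrightarrow> x j \<le> B"
    by blast
  obtain js where js: "js \<in> index_tuples n (m - 1)" "A (j # js) \<noteq> 0" "k \<in> set js"
    using step(2) by (auto simp: arcs_tensor_digraph)
  have j: "j \<in> V"
    using step(2) arc_tensor_digraph_verts by blast
  have a: "0 < A (j # js)"
    using entry_nonneg[OF j js(1)] js(2) by simp
  show ?case
  proof (intro exI allI impI)
    fix x :: "nat \<Rightarrow> real"
    assume x: "\<forall>k\<in>V. 1 \<le> x k" "\<forall>k\<in>V. T x k \<le> C * x k ^ (m - 1)" "x i = 1"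
    have x0: "0 \<le> x l" if "l \<in> V" for l
      using x(1) that by force
    have "A (j # js) * x k \<le> A (j # js) * (\<Prod>l\<leftarrow>js. x l)"
      using a x(1) js by (intro mult_left_mono le_prod_list_map) (auto simp: index_tuples_def)
    also have "\<dots> \<le> T x j"
      using j js(1) x0 by (intro term_le_apply)
    also have "\<dots> \<le> C * x j ^ (m - 1)"
      using x(2) j by blast
    also have "\<dots> \<le> C * B ^ (m - 1)"
      using B[OF x] x0[OF j] assms(1) by (intro mult_left_mono power_mono)
    finally show "x k \<le> C * B ^ (m - 1) / A (j # js)"
      using a by (simp add: pos_le_divide_eq mult.commute)
  qed
qed

text \<open>The maximum of the path bounds over the finitely many pairs of indices serves all of
  them. It confines vectors normalised to least coordinate 1 to a compact box.\<close>

lemma super_eigenvector_bound: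
  assumes "0 \<le> C"
  shows "\<exists>B. \<forall>x i j. i \<in> V \<longrightarrow> j \<in> V \<longrightarrow> (\<forall>k\<in>V. 1 \<le> x k) \<longrightarrow>
           (\<forall>k\<in>V. T x k \<le> C * x k ^ (m - 1)) \<longrightarrow> x i = 1 \<longrightarrow> x j \<le> B"
proof -
  obtain B where B: "\<And>x i j. i \<in> V \<Longrightarrow> j \<in> V \<Longrightarrow> \<forall>k\<in>V. 1 \<le> x k \<Longrightarrow>
      \<forall>k\<in>V. T x k \<le> C * x k ^ (m - 1) \<Longrightarrow> x i = 1 \<Longrightarrow> x j \<le> B i j"
    using super_eigenvector_path_bound[OF assms rtrancl_arcs] by metis
  show ?thesis
  proof (intro exI allI impI)
    fix x :: "nat \<Rightarrow> real" and i j
    assume h: "i \<in> V" "j \<in> V" "\<forall>k\<in>V. 1 \<le> x k" "\<forall>k\<in>V. T x k \<le> C * x k ^ (m - 1)" "x i = 1"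
    have "B i j \<le> Max ((\<lambda>(i, j). B i j) ` (V \<times> V))"
      using h(1,2) by (intro Max_ge) force+
    then show "x j \<le> Max ((\<lambda>(i, j). B i j) ` (V \<times> V))"
      using B[OF h] by linarith
  qed
qed

text \<open>The function \<open>r\<close> is the upper Collatz-Wielandt quotient and
  \<open>l\<close> its minimum over a compact box. A positive \<open>y\<close> violating the last
  property would, after rescaling, lie in the box and have a smaller quotient.\<close>

lemma minimal_super_eigenvector:
  obtains x l where "\<And>i. i \<in> V \<Longrightarrow> 0 < x i" and "\<And>i. i \<in> V \<Longrightarrow> T x i \<le> l * x i ^ (m - 1)"
    and "\<And>y. (\<And>i. i \<in> V \<Longrightarrow> 0 < y i) \<Longrightarrow> \<exists>i\<in>V. l * y i ^ (m - 1) \<le> T y i"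
proof -
  define r where "r = (\<lambda>x. Max ((\<lambda>i. T x i / x i ^ (m - 1)) ` V))"
  have r_ge: "T x i \<le> r x * x i ^ (m - 1)" if "i \<in> V" "0 < x i" for x i
  proof -
    have "T x i / x i ^ (m - 1) \<le> r x"
      unfolding r_def using that by (intro Max_ge) auto
    then show ?thesis
      using that by (simp add: pos_divide_le_eq)
  qed
  \<comment> \<open>The quotient of the constant vector 1. Only vectors with quotient at most
    \<open>C\<close> compete, and these are bounded once normalised.\<close>
  define C where "C = r (\<lambda>_. 1)"
  obtain v where v: "v \<in> V"
    using V_nonempty by auto
  have "0 \<le> C"
    using r_ge[OF v, of "\<lambda>_. 1"] apply_nonneg[OF v, of "\<lambda>_. 1"] by (auto simp: C_def)
  then obtain B where B: "\<And>x i j. i \<in> V \<Longrightarrow> j \<in> V \<Longrightarrow> \<forall>k\<in>V. 1 \<le> x k \<Longrightarrow>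
      \<forall>k\<in>V. T x k \<le> C * x k ^ (m - 1) \<Longrightarrow> x i = 1 \<Longrightarrow> x j \<le> B"
    using super_eigenvector_bound[of C] by metis
  \<comment> \<open>Vectors are total functions, so the box also restricts the coordinates outside
    \<open>V\<close>; \<open>max 1 B\<close> puts the constant vector 1 into it.\<close>
  define X where "X = Pi\<^sub>E UNIV (\<lambda>_ :: nat. {1 .. max 1 B})"
  have "compact X"
    unfolding X_def by (rule compact_PiE_UNIV) simp
  moreover have one: "(\<lambda>_. 1) \<in> X"
    by (auto simp: X_def)
  moreover have "continuous_on X r"
    unfolding r_def
  proof (intro continuous_on_Max_image continuous_on_divide continuous_on_tensor_apply_real
      continuous_on_power continuous_on_coordinate)
    show "\<forall>x\<in>X. x i ^ (m - 1) \<noteq> 0" if "i \<in> V" for i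
      by (auto simp: X_def PiE_def Pi_def) (metis not_one_le_zero)
  qed (use V_nonempty in auto)
  ultimately obtain x where x: "x \<in> X" "\<And>y. y \<in> X \<Longrightarrow> r x \<le> r y"
    using continuous_attains_inf[of X r] by blast
  have x_pos: "0 < x i" for i
    using x(1) by (auto simp: X_def PiE_def Pi_def intro: less_le_trans[of 0 1])
  show ?thesis
  proof (rule that[of x "r x"])
    show "0 < x i" for i
      by (rule x_pos)
    show "T x i \<le> r x * x i ^ (m - 1)" if "i \<in> V" for i
      using that x_pos by (rule r_ge)
    fix y :: "nat \<Rightarrow> real"
    assume y: "\<And>i. i \<in> V \<Longrightarrow> 0 < y i"
    show "\<exists>i\<in>V. r x * y i ^ (m - 1) \<le> T y i"
    proof (rule ccontr)
      assume "\<not> ?thesis"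
      then have lt: "T y i < r x * y i ^ (m - 1)" if "i \<in> V" for i
        using that by force
      define c where "c = Min (y ` V)"
      have "c \<in> y ` V"
        unfolding c_def using V_nonempty by (intro Min_in) auto
      then obtain i where i: "i \<in> V" "y i = c"
        by auto
      have c: "0 < c"
        using y[OF i(1)] i(2) by simp
      \<comment> \<open>Rescaled so that the least coordinate on \<open>V\<close> becomes 1, and set
        to 1 outside \<open>V\<close> in order to lie in \<open>X\<close>.\<close>
      define z where "z = (\<lambda>j. if j \<in> V then (1 / c) * y j else 1)"
      have z_ge: "1 \<le> z j" for j
      proof (cases "j \<in> V")
        case True
        then have "c \<le> y j"
          unfolding c_def by (intro Min_le) auto
        then show ?thesis
          using c by (simp add: z_def)
      qed (auto simp: z_def)
      have lt': "T z j < r x * z j ^ (m - 1)" if j: "j \<in> V" for j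
      proof -
        have "T z j = T (\<lambda>j. (1 / c) * y j) j"
          by (rule tensor_apply_real_cong) (auto simp: z_def)
        also have "\<dots> = (1 / c) ^ (m - 1) * T y j"
          by (rule tensor_apply_real_scale)
        also have "\<dots> < (1 / c) ^ (m - 1) * (r x * y j ^ (m - 1))"
          using lt[OF j] c by (intro mult_strict_left_mono) auto
        also have "\<dots> = r x * z j ^ (m - 1)"
          using j by (simp add: z_def power_divide)
        finally show ?thesis .
      qed
      have "r x \<le> C"
        unfolding C_def using one by (rule x(2))
      then have "T z j \<le> C * z j ^ (m - 1)" if "j \<in> V" for j
      proof -
        have "0 \<le> z j ^ (m - 1)"
          using z_ge[of j] by simp
        then show ?thesis
          using lt'[OF that] mult_right_mono[OF \<open>r x \<le> C\<close>, of "z j ^ (m - 1)"] by linarith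
      qed
      moreover have "z i = 1"
        using i c by (simp add: z_def)
      ultimately have "z j \<le> B" if "j \<in> V" for j
        using B[OF i(1) that, of z] z_ge by blast
      then have "z j \<le> max 1 B" for j
        by (cases "j \<in> V") (auto simp: z_def le_max_iff_disj)
      then have "z \<in> X"
        using z_ge by (auto simp: X_def)
      moreover have "r z < r x"
      proof -
        have "r z = Max ((\<lambda>i. T z i / z i ^ (m - 1)) ` V)"
          by (simp only: r_def)
        moreover
        have "T z j / z j ^ (m - 1) < r x" if "j \<in> V" for j
          using lt'[OF that] z_ge[of j] by (subst pos_divide_less_eq) (auto intro!: zero_less_power)
        ultimately show ?thesis
          using V_nonempty by (auto simp: Max_less_iff)
      qed
      ultimately show False
        using x(2)[of z] by simp
    qed
  qed
qed

text \<open>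
  Among the minimal super-eigenvectors, one with the most strict inequalities has none: lowering
  its coordinates at strict indices would make every in-neighbour of a strict index strict too.
\<close>

lemma positive_eigenvector:
  obtains x l where "\<And>i. i \<in> V \<Longrightarrow> 0 < x i" and "\<And>i. i \<in> V \<Longrightarrow> T x i = l * x i ^ (m - 1)" and "0 < l"
proof -
  obtain x0 l where x0: "\<And>i. i \<in> V \<Longrightarrow> 0 < x0 i" "\<And>i. i \<in> V \<Longrightarrow> T x0 i \<le> l * x0 i ^ (m - 1)"
    and minimal: "\<And>y. (\<And>i. i \<in> V \<Longrightarrow> 0 < y i) \<Longrightarrow> \<exists>i\<in>V. l * y i ^ (m - 1) \<le> T y i"
    using minimal_super_eigenvector by blast
  define W where "W = (\<lambda>x. \<forall>i\<in>V. 0 < x i \<and> T x i \<le> l * x i ^ (m - 1))"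
  define S where "S = (\<lambda>x. {i\<in>V. T x i < l * x i ^ (m - 1)})"
  have "card (S y) < Suc (card V)" for y
    unfolding less_Suc_eq_le by (intro card_mono) (auto simp: S_def)
  moreover have "W x0"
    using x0 by (auto simp: W_def)
  ultimately have "\<exists>x. W x \<and> (\<forall>y. W y \<longrightarrow> card (S y) \<le> card (S x))"
    by (intro Lattices_Big.ex_has_greatest_nat[where b = "Suc (card V)"]) blast+
  then obtain x where x: "W x" "\<And>y. W y \<Longrightarrow> card (S y) \<le> card (S x)"
    by blast
  have x_pos: "0 < x i" and x_le: "T x i \<le> l * x i ^ (m - 1)" if "i \<in> V" for i
    using x(1) that by (auto simp: W_def)
  have "S x = {}"
  proof (rule ccontr)
    assume ne: "S x \<noteq> {}"
    \<comment> \<open>Minimality of \<open>l\<close>, applied to \<open>x\<close> itself, gives an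
      index without strict inequality. So \<open>S x\<close> is not all of \<open>V\<close>, and
      some arc enters it from outside.\<close>
    obtain i where i: "i \<in> V" "l * x i ^ (m - 1) \<le> T x i"
      using minimal[of x] x_pos by blast
    then have "i \<notin> S x"
      by (simp add: S_def)
    then have "S x \<noteq> V"
      using i(1) by blast
    moreover have SV: "S x \<subseteq> V"
      by (auto simp: S_def)
    ultimately obtain k i where ki: "(k, i) \<in> E" "i \<in> S x" "k \<notin> S x"
      using backward_closed_eq_V[OF _ ne] SV by blast
    have k: "k \<in> V"
      using ki(1) arc_tensor_digraph_verts by blast
    have "\<exists>u. 0 < u \<and> u < x j \<and> T x j < l * u ^ (m - 1)" if "j \<in> S x" for j
    proof -
      have j: "j \<in> V" "T x j < l * x j ^ (m - 1)"
        using that by (auto simp: S_def)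
      \<comment> \<open>By continuity, \<open>u\<close> can be chosen so close below
        \<open>x j\<close> that the old value \<open>T x j\<close> stays strictly dominated.
        Lowering coordinates can only decrease \<open>T\<close>.\<close>
      have "((\<lambda>u. l * u ^ (m - 1)) \<longlongrightarrow> l * x j ^ (m - 1)) (at_left (x j))"
        by (intro tendsto_intros)
      then have "\<forall>\<^sub>F u in at_left (x j). T x j < l * u ^ (m - 1)"
        using j(2) by (rule order_tendstoD)
      moreover have "\<forall>\<^sub>F u in at_left (x j). u \<in> {0<..<x j}"
        using x_pos[OF j(1)] by (rule eventually_at_left_real)
      ultimately have "\<forall>\<^sub>F u in at_left (x j). 0 < u \<and> u < x j \<and> T x j < l * u ^ (m - 1)"
        by eventually_elim auto
      then show ?thesis
        using eventually_happens'[OF trivial_limit_at_left_real] by blast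
    qed
    then obtain u where u: "\<And>j. j \<in> S x \<Longrightarrow> 0 < u j \<and> u j < x j \<and> T x j < l * u j ^ (m - 1)"
      by metis
    define y where "y = (\<lambda>j. if j \<in> S x then u j else x j)"
    have y: "0 < y j \<and> y j \<le> x j" if "j \<in> V" for j
      using u x_pos[OF that] by (auto simp: y_def intro: less_imp_le)
    have Ty: "T y j \<le> T x j" if "j \<in> V" for j
      using that y by (intro apply_mono) (auto intro: less_imp_le)
    have strict: "T y j < l * y j ^ (m - 1)" if "j \<in> S x" for j
      using u[OF that] Ty[of j] that by (auto simp: y_def S_def)
    \<comment> \<open>The coordinate at \<open>k\<close> is kept, while the one at its out-neighbour
      \<open>i\<close> is lowered.\<close>
    have "T y k < T x k"
      using ki(1) y u[OF ki(2)] ki(2) by (intro apply_strict_mono[of k i]) (auto simp: y_def)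
    then have strict_k: "T y k < l * y k ^ (m - 1)"
      using x_le[OF k] ki(3) by (simp add: y_def)
    have "W y"
      unfolding W_def
    proof (intro ballI conjI)
      fix j assume j: "j \<in> V"
      show "0 < y j"
        using y j by blast
      show "T y j \<le> l * y j ^ (m - 1)"
        using strict[of j] Ty[OF j] x_le[OF j] by (cases "j \<in> S x") (auto simp: y_def)
    qed
    moreover have "insert k (S x) \<subseteq> S y"
      using strict strict_k k by (auto simp: S_def)
    then have "card (insert k (S x)) \<le> card (S y)"
      by (intro card_mono) (auto simp: S_def)
    then have "card (S x) < card (S y)"
      using ki(3) by (simp add: S_def)
    ultimately show False
      using x(2)[of y] by simp
  qed
  then have eq: "T x i = l * x i ^ (m - 1)" if "i \<in> V" for i
    using x_le[OF that] that by (force simp: S_def)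
  obtain v where v: "v \<in> V"
    using V_nonempty by auto
  have "0 < l * x v ^ (m - 1)"
    using apply_pos[of v x] x_pos v eq[OF v] by metis
  then have "0 < l"
    using x_pos[OF v] by (simp add: zero_less_mult_iff)
  then show ?thesis
    using that x_pos eq by blast
qed

section \<open>Identification of the spectral radius\<close>

lemma norm_eigenvalue_le:
  assumes x: "\<And>i. i \<in> V \<Longrightarrow> 0 < x i" "\<And>i. i \<in> V \<Longrightarrow> T x i = l * x i ^ (m - 1)"
    and ev: "tensor_eigenvalue m n (\<lambda>is. complex_of_real (A is)) \<mu>"
  shows "cmod \<mu> \<le> l"
proof -
  obtain z where z: "\<exists>i\<in>V. z i \<noteq> 0"
    "\<And>i. i \<in> V \<Longrightarrow> tensor_apply m n (\<lambda>is. complex_of_real (A is)) z i = \<mu> * z i ^ (m - 1)"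
    using ev unfolding tensor_eigenvalue_def by blast
  define t where "t = Max ((\<lambda>i. cmod (z i) / x i) ` V)"
  have "t \<in> (\<lambda>i. cmod (z i) / x i) ` V"
    unfolding t_def using V_nonempty by (intro Max_in) auto
  then obtain i where i: "i \<in> V" "t = cmod (z i) / x i"
    by auto
  have t_ge: "cmod (z j) / x j \<le> t" if "j \<in> V" for j
    unfolding t_def using that by (intro Max_ge) auto
  obtain k where k: "k \<in> V" "z k \<noteq> 0"
    using z(1) by auto
  then have "0 < cmod (z k) / x k"
    using x(1)[of k] by simp
  then have t: "0 < t"
    using t_ge[OF k(1)] by linarith
  have zi: "cmod (z i) = t * x i"
    using i x(1)[OF i(1)] by simp
  have norm_prod: "cmod (\<Prod>j\<leftarrow>js. z j) = (\<Prod>j\<leftarrow>js. cmod (z j))" for js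
    by (induction js) (auto simp: norm_mult)
  \<comment> \<open>The moduli of \<open>z\<close> are at most \<open>t\<close> times the
    coordinates of \<open>x\<close>, with equality at \<open>i\<close>. Hence both ends of the chain
    carry the same positive factor, which cancels.\<close>
  have "cmod \<mu> * (t ^ (m - 1) * x i ^ (m - 1)) = cmod (\<mu> * z i ^ (m - 1))"
    by (simp add: norm_mult norm_power zi power_mult_distrib)
  also have "\<dots> = cmod (tensor_apply m n (\<lambda>is. complex_of_real (A is)) z i)"
    using z(2) i(1) by simp
  also have "\<dots> \<le> (\<Sum>js\<in>index_tuples n (m - 1). cmod (complex_of_real (A (i # js)) * (\<Prod>j\<leftarrow>js. z j)))"
    unfolding tensor_apply_def by (rule norm_sum)
  also have "\<dots> = T (\<lambda>j. cmod (z j)) i"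
    unfolding tensor_apply_real_def using entry_nonneg[OF i(1)]
    by (intro sum.cong) (auto simp: norm_mult norm_prod)
  also have "\<dots> \<le> T (\<lambda>j. t * x j) i"
    using t_ge x(1) i(1) by (intro apply_mono) (auto simp: pos_divide_le_eq)
  also have "\<dots> = l * (t ^ (m - 1) * x i ^ (m - 1))"
    using x(2)[OF i(1)] by (simp add: tensor_apply_real_scale)
  finally show ?thesis
    by (rule mult_right_le_imp_le) (use t x(1)[OF i(1)] in auto)
qed

text \<open>The maximum is attained: \<open>l\<close> is itself an eigenvalue, with \<open>x\<close>
  read as a complex vector, and its modulus is \<open>l\<close> because \<open>l\<close> is
  positive.\<close>

lemma spectral_radius_eq:
  assumes x: "\<And>i. i \<in> V \<Longrightarrow> 0 < x i" "\<And>i. i \<in> V \<Longrightarrow> T x i = l * x i ^ (m - 1)" and "0 < l"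
  shows "tensor_spectral_radius m n (\<lambda>is. complex_of_real (A is)) = l"
  unfolding tensor_spectral_radius_def
proof (rule Greatest_equality)
  have "tensor_eigenvalue m n (\<lambda>is. complex_of_real (A is)) (complex_of_real l)"
    unfolding tensor_eigenvalue_def
  proof (intro exI[of _ "\<lambda>j. complex_of_real (x j)"] conjI ballI)
    show "\<exists>i\<in>V. complex_of_real (x i) \<noteq> 0"
      using V_nonempty x(1) by fastforce
  qed (use x(2) in \<open>simp add: tensor_apply_of_real\<close>)
  then show "\<exists>\<mu>. tensor_eigenvalue m n (\<lambda>is. complex_of_real (A is)) \<mu> \<and> l = cmod \<mu>"
    using \<open>0 < l\<close> by (intro exI[of _ "complex_of_real l"]) simp
qed (use norm_eigenvalue_le[OF x] in auto)

section \<open>Circuits of out-neighbour maps and slice sums\<close>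

text \<open>Iterating \<open>f\<close> in the finite set \<open>V\<close> reaches a recurrent vertex
  \<open>v\<close>. Its orbit is permuted by \<open>f\<close> and traversed by a circuit with
  \<open>card C\<close> arcs, which the girth cannot exceed.\<close>

lemma functional_subgraph_cycle:
  assumes f: "\<And>i. i \<in> V \<Longrightarrow> (i, f i) \<in> E"
  obtains C where "C \<subseteq> V" "bij_betw f C C" "digraph_girth (tensor_digraph m n A) \<le> enat (card C)"
proof -
  interpret G: wf_digraph "tensor_digraph m n A"
    by (rule wf_tensor_digraph)
  obtain v0 where v0: "v0 \<in> V"
    using V_nonempty by auto
  have fV: "(f ^^ k) w \<in> V" if "w \<in> V" for k w
    using that
  proof (induction k)
    case (Suc k)
    then show ?case
      using arc_tensor_digraph_verts[OF f[of "(f ^^ k) w"]] by simp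
  qed simp
  have "finite (range (\<lambda>k. (f ^^ k) v0))"
    by (rule finite_subset[of _ V]) (use fV[OF v0] in blast, simp)
  then have "\<not> inj (\<lambda>k. (f ^^ k) v0)"
    using finite_imageD[of "\<lambda>k. (f ^^ k) v0" UNIV] by (auto simp del: finite_imageD)
  then obtain a b where ab: "a < b" "(f ^^ a) v0 = (f ^^ b) v0"
    unfolding inj_def by (metis linorder_neqE_nat)
  define v where "v = (f ^^ a) v0"
  have v: "v \<in> V"
    using fV v0 by (simp add: v_def)
  have "(f ^^ (b - a)) v = v"
    unfolding v_def using ab by (metis comp_apply funpow_add le_add_diff_inverse2 less_imp_le)
  then have orb: "v \<in> orbit f v"
    using ab(1) unfolding orbit_altdef by (metis (mono_tags, lifting) mem_Collect_eq zero_less_diff)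
  define C where "C = orbit f v"
  \<comment> \<open>The least positive period of \<open>v\<close>.\<close>
  define p where "p = funpow_dist1 f v v"
  have C: "C = (\<lambda>k. (f ^^ k) v) ` {0..<p}"
    unfolding C_def p_def by (rule orbit_conv_funpow_dist1[OF orb])
  have CV: "C \<subseteq> V"
    using fV[OF v] by (auto simp: C)
  have inj: "inj_on (\<lambda>k. (f ^^ k) v) {0..<p}"
    unfolding p_def using orb by (rule inj_on_funpow_dist1)
  have card: "card C = p"
    unfolding C using inj by (simp add: card_image)
  have per: "(f ^^ p) v = v"
    unfolding p_def by (rule funpow_dist1_prop[OF orb])
  have "f ` C = C"
  proof
    show "f ` C \<subseteq> C"
      unfolding C_def by (auto intro: orbit.step)
    show "C \<subseteq> f ` C"
    proof
      fix w assume "w \<in> C"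
      then show "w \<in> f ` C"
        unfolding C_def by (cases rule: orbit.cases) (use orb in auto)
    qed
  qed
  then have bij: "bij_betw f C C"
    using CV finite_subset[OF CV] by (simp add: bij_betw_def finite_surj_inj)
  \<comment> \<open>The arc walk of the first \<open>k\<close> steps from \<open>v\<close>; it
    closes up at \<open>k = p\<close>.\<close>
  define w where "w = (\<lambda>k. map (\<lambda>k. ((f ^^ k) v, (f ^^ Suc k) v)) [0..<k])"
  have cas: "G.cas v (w k) ((f ^^ k) v)" for k
  proof (induction k)
    case 0
    then show ?case
      by (simp add: w_def G.cas.simps)
  next
    case (Suc k)
    have "w (Suc k) = w k @ [((f ^^ k) v, (f ^^ Suc k) v)]"
      by (simp add: w_def)
    then show ?case
      using Suc G.awlast_if_cas[OF Suc] by (simp add: G.cas.simps tensor_digraph_simps)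
  qed
  have "G.awalk v (w p) v"
    unfolding G.awalk_def
  proof (intro conjI)
    show "set (w p) \<subseteq> arcs (tensor_digraph m n A)"
      using f fV[OF v] by (auto simp: w_def simp del: atLeastAtMost_iff)
    show "G.cas v (w p) v"
      using cas[of p] per by simp
  qed (use v in \<open>simp add: tensor_digraph_def\<close>)
  moreover have "w p \<noteq> []"
    by (simp add: w_def p_def)
  moreover have "distinct (tl (G.awalk_verts v (w p)))"
  proof -
    \<comment> \<open>Without its first vertex, the walk visits the images under \<open>f\<close> of
      the orbit points, which are distinct because \<open>f\<close> is injective on
      \<open>C\<close>.\<close>
    have "tl (G.awalk_verts v (w p)) = map (\<lambda>k. f ((f ^^ k) v)) [0..<p]"
      unfolding G.awalk_verts_conv'[OF cas] using \<open>w p \<noteq> []\<close>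
      by (simp add: w_def tensor_digraph_simps)
    moreover have "inj_on (f \<circ> (\<lambda>k. (f ^^ k) v)) {0..<p}"
      using bij inj by (intro comp_inj_on) (auto simp: C bij_betw_def)
    ultimately show ?thesis
      by (simp add: distinct_map comp_def)
  qed
  ultimately have "G.cycle (w p)"
    unfolding G.cycle_def by blast
  then have "digraph_girth (tensor_digraph m n A) \<le> enat (length (w p))"
    unfolding digraph_girth_def by (intro INF_lower) simp
  then show ?thesis
    using that[OF CV bij] card by (simp add: w_def)
qed

text \<open>A nonzero entry involves only out-neighbours of \<open>i\<close>, so bounding
  \<open>x\<close> on these suffices.\<close>

lemma apply_le_slice_sum:
  assumes "i \<in> V" and "\<And>j. j \<in> V \<Longrightarrow> 0 \<le> x j" and "\<And>j. (i, j) \<in> E \<Longrightarrow> x j \<le> c"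
  shows "T x i \<le> slice_sum m n A i * c ^ (m - 1)"
  unfolding tensor_apply_real_def slice_sum_def sum_distrib_right
proof (rule sum_mono)
  fix js assume js: "js \<in> index_tuples n (m - 1)"
  show "A (i # js) * (\<Prod>j\<leftarrow>js. x j) \<le> A (i # js) * c ^ (m - 1)"
  proof (cases "A (i # js) = 0")
    case False
    then have "(i, j) \<in> E" if "j \<in> set js" for j
      using js that assms(1) by (auto simp: arcs_tensor_digraph)
    then have "(\<Prod>j\<leftarrow>js. x j) \<le> (\<Prod>j\<leftarrow>js. c)"
      using assms js by (intro prod_list_map_mono) (auto simp: index_tuples_def)
    then show ?thesis
      using js entry_nonneg[OF assms(1) js]
      by (intro mult_left_mono) (auto simp: prod_list_map_const index_tuples_def)
  qed simp
qed

lemma slice_sum_le_apply: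
  assumes "i \<in> V" and "0 \<le> c" and "\<And>j. (i, j) \<in> E \<Longrightarrow> c \<le> x j"
  shows "slice_sum m n A i * c ^ (m - 1) \<le> T x i"
  unfolding tensor_apply_real_def slice_sum_def sum_distrib_right
proof (rule sum_mono)
  fix js assume js: "js \<in> index_tuples n (m - 1)"
  show "A (i # js) * c ^ (m - 1) \<le> A (i # js) * (\<Prod>j\<leftarrow>js. x j)"
  proof (cases "A (i # js) = 0")
    case False
    then have "(i, j) \<in> E" if "j \<in> set js" for j
      using js that assms(1) by (auto simp: arcs_tensor_digraph)
    then have "(\<Prod>j\<leftarrow>js. c) \<le> (\<Prod>j\<leftarrow>js. x j)"
      using assms by (intro prod_list_map_mono) auto
    then show ?thesis
      using js entry_nonneg[OF assms(1) js]
      by (intro mult_left_mono) (auto simp: prod_list_map_const index_tuples_def)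
  qed simp
qed

lemma slice_sum_pos: "i \<in> V \<Longrightarrow> 0 < slice_sum m n A i"
  using apply_pos[of i "\<lambda>_. 1"] by (simp add: tensor_apply_real_one)

lemma finite_out_neighbours: "finite {j. (i, j) \<in> E}"
  by (rule finite_subset[of _ V]) (use arc_tensor_digraph_verts in blast, simp)

text \<open>
  Along a circuit of arcs to a maximal (minimal) out-neighbour, the coordinates of the
  eigenvector cancel from the product of the eigenvalue equations.
\<close>

lemma ln_eigenvalue_le_cycle_average:
  assumes x: "\<And>i. i \<in> V \<Longrightarrow> 0 < x i" "\<And>i. i \<in> V \<Longrightarrow> T x i = l * x i ^ (m - 1)" and l: "0 < l"
  obtains C where "C \<subseteq> V" "digraph_girth (tensor_digraph m n A) \<le> enat (card C)"
    "card C * ln l \<le> (\<Sum>i\<in>C. ln (slice_sum m n A i))"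
proof -
  have "\<exists>j. (i, j) \<in> E \<and> (\<forall>k. (i, k) \<in> E \<longrightarrow> x k \<le> x j)" if "i \<in> V" for i
  proof -
    have "Max (x ` {j. (i, j) \<in> E}) \<in> x ` {j. (i, j) \<in> E}"
      using out_arc[OF that] finite_out_neighbours[of i] by (intro Max_in) auto
    then obtain j where "(i, j) \<in> E" "Max (x ` {j. (i, j) \<in> E}) = x j"
      by auto
    moreover have "x k \<le> Max (x ` {j. (i, j) \<in> E})" if "(i, k) \<in> E" for k
      using that finite_out_neighbours[of i] by (intro Max_ge) auto
    ultimately show ?thesis
      by auto
  qed
  then obtain f where f: "\<And>i. i \<in> V \<Longrightarrow> (i, f i) \<in> E"
    "\<And>i k. i \<in> V \<Longrightarrow> (i, k) \<in> E \<Longrightarrow> x k \<le> x (f i)"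
    by metis
  obtain C where C: "C \<subseteq> V" "bij_betw f C C" "digraph_girth (tensor_digraph m n A) \<le> enat (card C)"
    using functional_subgraph_cycle[of f] f(1) by blast
  have "ln l + (m - 1) * ln (x i) \<le> ln (slice_sum m n A i) + (m - 1) * ln (x (f i))" if "i \<in> C" for i
  proof -
    have i: "i \<in> V" "f i \<in> V"
      using that C(1) f(1) arc_tensor_digraph_verts by blast+
    have "l * x i ^ (m - 1) \<le> slice_sum m n A i * x (f i) ^ (m - 1)"
      using apply_le_slice_sum[OF i(1), of x "x (f i)"] x(2)[OF i(1)] f(2)[OF i(1)] x(1)
      by (auto intro: less_imp_le)
    then have "ln (l * x i ^ (m - 1)) \<le> ln (slice_sum m n A i * x (f i) ^ (m - 1))"
      using l x(1)[OF i(1)] by (subst ln_le_cancel_iff) (auto intro: less_le_trans[rotated])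
    then show ?thesis
      using l x(1)[OF i(1)] x(1)[OF i(2)] slice_sum_pos[OF i(1)] by (simp add: ln_mult ln_realpow)
  qed
  then have "(\<Sum>i\<in>C. ln l + (m - 1) * ln (x i)) \<le>
      (\<Sum>i\<in>C. ln (slice_sum m n A i) + (m - 1) * ln (x (f i)))"
    by (rule sum_mono)
  moreover have "(\<Sum>i\<in>C. ln (x (f i))) = (\<Sum>i\<in>C. ln (x i))"
    using C(2) by (rule sum.reindex_bij_betw)
  ultimately have "card C * ln l \<le> (\<Sum>i\<in>C. ln (slice_sum m n A i))"
    by (simp add: sum.distrib flip: sum_distrib_left)
  then show ?thesis
    using that C by blast
qed

lemma cycle_average_le_ln_eigenvalue:
  assumes x: "\<And>i. i \<in> V \<Longrightarrow> 0 < x i" "\<And>i. i \<in> V \<Longrightarrow> T x i = l * x i ^ (m - 1)" and l: "0 < l"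
  obtains C where "C \<subseteq> V" "digraph_girth (tensor_digraph m n A) \<le> enat (card C)"
    "(\<Sum>i\<in>C. ln (slice_sum m n A i)) \<le> card C * ln l"
proof -
  have "\<exists>j. (i, j) \<in> E \<and> (\<forall>k. (i, k) \<in> E \<longrightarrow> x j \<le> x k)" if "i \<in> V" for i
  proof -
    have "Min (x ` {j. (i, j) \<in> E}) \<in> x ` {j. (i, j) \<in> E}"
      using out_arc[OF that] finite_out_neighbours[of i] by (intro Min_in) auto
    then obtain j where "(i, j) \<in> E" "Min (x ` {j. (i, j) \<in> E}) = x j"
      by auto
    moreover have "Min (x ` {j. (i, j) \<in> E}) \<le> x k" if "(i, k) \<in> E" for k
      using that finite_out_neighbours[of i] by (intro Min_le) auto
    ultimately show ?thesis
      by auto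
  qed
  then obtain f where f: "\<And>i. i \<in> V \<Longrightarrow> (i, f i) \<in> E"
    "\<And>i k. i \<in> V \<Longrightarrow> (i, k) \<in> E \<Longrightarrow> x (f i) \<le> x k"
    by metis
  obtain C where C: "C \<subseteq> V" "bij_betw f C C" "digraph_girth (tensor_digraph m n A) \<le> enat (card C)"
    using functional_subgraph_cycle[of f] f(1) by blast
  have "ln (slice_sum m n A i) + (m - 1) * ln (x (f i)) \<le> ln l + (m - 1) * ln (x i)" if "i \<in> C" for i
  proof -
    have i: "i \<in> V" "f i \<in> V"
      using that C(1) f(1) arc_tensor_digraph_verts by blast+
    have "slice_sum m n A i * x (f i) ^ (m - 1) \<le> l * x i ^ (m - 1)"
      using slice_sum_le_apply[OF i(1), of "x (f i)" x] x(2)[OF i(1)] f(2)[OF i(1)] x(1)[OF i(2)]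
      by auto
    then have "ln (slice_sum m n A i * x (f i) ^ (m - 1)) \<le> ln (l * x i ^ (m - 1))"
      using l x(1)[OF i(1)] x(1)[OF i(2)] slice_sum_pos[OF i(1)] by (subst ln_le_cancel_iff) auto
    then show ?thesis
      using l x(1)[OF i(1)] x(1)[OF i(2)] slice_sum_pos[OF i(1)] by (simp add: ln_mult ln_realpow)
  qed
  then have "(\<Sum>i\<in>C. ln (slice_sum m n A i) + (m - 1) * ln (x (f i))) \<le>
      (\<Sum>i\<in>C. ln l + (m - 1) * ln (x i))"
    by (rule sum_mono)
  moreover have "(\<Sum>i\<in>C. ln (x (f i))) = (\<Sum>i\<in>C. ln (x i))"
    using C(2) by (rule sum.reindex_bij_betw)
  ultimately have "(\<Sum>i\<in>C. ln (slice_sum m n A i)) \<le> card C * ln l"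
    by (simp add: sum.distrib flip: sum_distrib_left)
  then show ?thesis
    using that C by blast
qed

end

section \<open>From averages of logarithms to geometric means\<close>

text \<open>Rewrites a root of a product in the logarithmic form in which the circuit estimates
  arrive.\<close>

lemma prod_powr_eq_exp_average:
  fixes K :: "'a \<Rightarrow> real"
  assumes "finite B" "\<And>i. i \<in> B \<Longrightarrow> 0 < K i"
  shows "(\<Prod>i\<in>B. K i) powr (1 / real g) = exp ((\<Sum>i\<in>B. ln (K i)) / g)"
proof -
  have "0 < (\<Prod>i\<in>B. K i)"
    using assms by (intro prod_pos) auto
  moreover have "ln (\<Prod>i\<in>B. K i) = (\<Sum>i\<in>B. ln (K i))"
    using assms(2) by (intro ln_prod assms(1)) (metis less_irrefl)
  ultimately show ?thesis
    by (simp add: powr_def)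
qed

theorem theorem3p3:
  fixes m n g :: nat and A :: "nat list \<Rightarrow> real" and K :: "nat \<Rightarrow> real"
  assumes "nonneg_tensor m n A"
    and "weakly_irreducible m n A"
    and "\<And>i. i \<in> {1..n} \<Longrightarrow> K i = slice_sum m n A i"
    and "mono_on {1..n} K"
    and "digraph_girth (tensor_digraph m n A) = enat g"
  shows "(\<Prod>i\<in>{1..g}. K i) powr (1 / real g)
           \<le> tensor_spectral_radius m n (\<lambda>is. complex_of_real (A is))
       \<and> tensor_spectral_radius m n (\<lambda>is. complex_of_real (A is))
           \<le> (\<Prod>i\<in>{n - g + 1..n}. K i) powr (1 / real g)"
proof -
  let ?G = "tensor_digraph m n A"
  interpret G: wf_digraph ?G
    by (rule wf_tensor_digraph)
  \<comment> \<open>The infimum over no circuits would be \<infinity>, so a finite girth yields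
    one.\<close>
  obtain p where p: "G.cycle p"
  proof (rule ccontr)
    assume "\<not> thesis"
    then have "{p. G.cycle p} = {}"
      using that by blast
    then show False
      using assms(5) by (simp add: digraph_girth_def top_enat_def)
  qed
  have "arcs ?G \<noteq> {}"
    using p by (auto simp: G.cycle_def G.awalk_def)
  then interpret weakly_irreducible_tensor m n A
    using assms by unfold_locales
  have "enat 1 \<le> enat g"
    unfolding assms(5)[symmetric] digraph_girth_def
    by (rule INF_greatest) (auto simp: G.cycle_def Suc_le_eq)
  then have g: "1 \<le> g"
    by simp
  obtain x l where x: "\<And>i. i \<in> V \<Longrightarrow> 0 < x i" "\<And>i. i \<in> V \<Longrightarrow> T x i = l * x i ^ (m - 1)" and l: "0 < l"
    using positive_eigenvector by blast
  have \<rho>: "tensor_spectral_radius m n (\<lambda>is. complex_of_real (A is)) = l"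
    using x l by (rule spectral_radius_eq)
  have K_pos: "0 < K i" if "i \<in> V" for i
    using slice_sum_pos[OF that] assms(3)[OF that] by simp
  have K_mono: "ln (K i) \<le> ln (K j)" if "i \<in> V" "j \<in> V" "i \<le> j" for i j
    using K_pos that mono_onD[OF assms(4)] by simp
  obtain C where C: "C \<subseteq> V" "g \<le> card C" "card C * ln l \<le> (\<Sum>i\<in>C. ln (slice_sum m n A i))"
    using ln_eigenvalue_le_cycle_average[OF x l] assms(5) by auto
  obtain D where D: "D \<subseteq> V" "g \<le> card D" "(\<Sum>i\<in>D. ln (slice_sum m n A i)) \<le> card D * ln l"
    using cycle_average_le_ln_eigenvalue[OF x l] assms(5) by auto
  \<comment> \<open>Guarantees that \<open>n - g\<close> is not truncated and that both blocks of
    indices have exactly \<open>g\<close> elements inside \<open>V\<close>.\<close>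
  have gn: "g \<le> n"
    using C(2) card_mono[OF _ C(1)] by simp
  have "ln l \<le> (\<Sum>i\<in>C. ln (K i)) / card C"
  proof -
    have "(\<Sum>i\<in>C. ln (slice_sum m n A i)) = (\<Sum>i\<in>C. ln (K i))"
      using C(1) assms(3) by (intro sum.cong) auto
    then show ?thesis
      using C g by (simp add: pos_le_divide_eq mult.commute)
  qed
  \<comment> \<open>By monotonicity of \<open>K\<close> the last \<open>g\<close> indices carry the
    largest logarithms, with threshold at the first index of this block.\<close>
  also have "\<dots> \<le> (\<Sum>i\<in>{n - g + 1..n}. ln (K i)) / card {n - g + 1..n}"
  proof (rule average_le_top_average[where V = V and c = "ln (K (n - g + 1))"])
    show "ln (K (n - g + 1)) \<le> ln (K i)" if "i \<in> {n - g + 1..n}" for i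
      using that g gn by (intro K_mono) auto
    show "ln (K i) \<le> ln (K (n - g + 1))" if "i \<in> V - {n - g + 1..n}" for i
      using that g gn by (intro K_mono) auto
  qed (use C(1,2) g gn in auto)
  finally have upper: "l \<le> exp ((\<Sum>i\<in>{n - g + 1..n}. ln (K i)) / g)"
    using l g gn by (simp add: ln_ge_iff flip: exp_le_cancel_iff[of "ln l"])
  \<comment> \<open>Negation turns the \<open>g\<close> smallest logarithms into the
    \<open>g\<close> largest values, so the same averaging inequality applies.\<close>
  have "(\<Sum>i\<in>D. - ln (K i)) / card D \<le> (\<Sum>i\<in>{1..g}. - ln (K i)) / card {1..g}"
  proof (rule average_le_top_average[where V = V and c = "- ln (K g)"])
    show "- ln (K g) \<le> - ln (K i)" if "i \<in> {1..g}" for i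
      using that g gn by (intro le_imp_neg_le K_mono) auto
    show "- ln (K i) \<le> - ln (K g)" if "i \<in> V - {1..g}" for i
      using that g gn by (intro le_imp_neg_le K_mono) auto
  qed (use D(1,2) g gn in auto)
  then have "(\<Sum>i\<in>{1..g}. ln (K i)) / g \<le> (\<Sum>i\<in>D. ln (K i)) / card D"
    by (simp add: sum_negf)
  also have "\<dots> \<le> ln l"
  proof -
    have "(\<Sum>i\<in>D. ln (slice_sum m n A i)) = (\<Sum>i\<in>D. ln (K i))"
      using D(1) assms(3) by (intro sum.cong) auto
    then show ?thesis
      using D g by (simp add: pos_divide_le_eq mult.commute)
  qed
  finally have "(\<Sum>i\<in>{1..g}. ln (K i)) / g \<le> ln l" .
  then have lower: "exp ((\<Sum>i\<in>{1..g}. ln (K i)) / g) \<le> l"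
    using l by (metis exp_le_cancel_iff exp_ln)
  show ?thesis
    unfolding \<rho> using upper lower gn K_pos by (subst (1 2) prod_powr_eq_exp_average) auto
qed

end
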